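(* Let $p,q\ge0$ be integers, let $a_1,a_2>0$ be real numbers, and let $\lambda>0$ satisfy $\lambda^{p+q}=(p+1)^p(q+1)^q$. Then $$\Sigma_a=\left\{(z_1,z_2)\in\mathbb{C}^2:\ \frac{|z_1|^2}{p+1}-\frac{|z_2|^2}{q+1}=\frac{a_1^2-a_2^2}{\lambda},\ \ \Re\left(z_1^{p+1}z_2^{q+1}\right)=\frac{a_1^{p+1}a_2^{q+1}\sqrt{(p+1)(q+1)}}{\lambda}\right\}$$ is a Lagrangian surface in $\mathbb{C}^2$ satisfying, for a suitable orientation, $$\beta_{\Sigma_a}+p\,\arg z_1+q\,\arg z_2=0\quad\text{in }\mathbb{R}/2\pi\mathbb{Z}\text{ on }\Sigma_a.$$
   Context: On $\mathbb{C}^2$ let $(z,w)=\sum_i z_i\bar w_i$, with Euclidean metric $\Re(\cdot,\cdot)$ and Kähler form $\omega=-\Im(\cdot,\cdot)$. A (smooth, embedded, real two-dimensional) surface $\Sigma\subset\mathbb{C}^2$ is Lagrangian if $\omega$ restricts to zero on it. For an oriented Lagrangian surface $\Sigma$, the Lagrangian angle map $\beta_\Sigma$ with values in $\mathbb{R}/2\pi\mathbb{Z}$ is defined by $e^{i\beta_\Sigma}=(dz_1\wedge dz_2)(e_1,e_2)$ for any oriented orthonormal tangent basis $e_1,e_2$. $\arg$ denotes the argument of a nonzero complex number, in $\mathbb{R}/2\pi\mathbb{Z}$. *)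

theory Defs
  imports "HOL-Analysis.Analysis" "HOL-Library.Real_Mod"
begin

text \<open>On an open set, \<open>k_smooth_on k\<close> means k times continuously differentiable; the domain
  is finite-dimensional, so it suffices to ask this of all directional derivatives.\<close>

primrec k_smooth_on ::
    "nat \<Rightarrow> 'a::euclidean_space set \<Rightarrow> ('a \<Rightarrow> 'b::real_normed_vector) \<Rightarrow> bool" where
  "k_smooth_on 0 U f \<longleftrightarrow> continuous_on U f"
| "k_smooth_on (Suc k) U f \<longleftrightarrow>
     (\<forall>x\<in>U. f differentiable (at x)) \<and>
     (\<forall>v. k_smooth_on k U (\<lambda>x. frechet_derivative f (at x) v))"

definition smooth_on ::
    "'a::euclidean_space set \<Rightarrow> ('a \<Rightarrow> 'b::real_normed_vector) \<Rightarrow> bool" where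
  "smooth_on U f \<longleftrightarrow> (\<forall>k. k_smooth_on k U f)"

text \<open>An embedded surface is locally, in the ambient space, the image of a smooth immersion
  of an open subset of the plane that is a homeomorphism onto its image.\<close>

definition smooth_surface :: "'a::euclidean_space set \<Rightarrow> bool" where
  "smooth_surface S \<longleftrightarrow>
     (\<forall>x\<in>S. \<exists>(U :: (real \<times> real) set) V f g.
        open U \<and> open V \<and> x \<in> V \<and>
        homeomorphism U (S \<inter> V) f g \<and> smooth_on U f \<and>
        (\<forall>u\<in>U. inj (frechet_derivative f (at u))))"

definition tangent_space :: "'a::euclidean_space set \<Rightarrow> 'a \<Rightarrow> 'a set" where
  "tangent_space S x =
     {v. \<exists>\<epsilon>>0. \<exists>\<gamma> :: real \<Rightarrow> 'a. smooth_on {-\<epsilon><..<\<epsilon>} \<gamma> \<and> \<gamma> ` {-\<epsilon><..<\<epsilon>} \<subseteq> S \<and>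
           \<gamma> 0 = x \<and> (\<gamma> has_vector_derivative v) (at 0)}"

definition tangent_basis :: "'a::euclidean_space set \<Rightarrow> 'a \<Rightarrow> 'a \<Rightarrow> 'a \<Rightarrow> bool" where
  "tangent_basis S x v w \<longleftrightarrow>
     v \<noteq> w \<and> independent {v, w} \<and> span {v, w} = tangent_space S x"

text \<open>An orientation sends each point to the set of positively oriented ordered bases of the
  tangent plane there: one of the two classes modulo change of basis with positive determinant,
  represented near each point by a continuous frame.\<close>

definition orientation_on ::
    "'a::euclidean_space set \<Rightarrow> ('a \<Rightarrow> ('a \<times> 'a) set) \<Rightarrow> bool" where
  "orientation_on S ori \<longleftrightarrow>
     (\<forall>x\<in>S. \<exists>v w. tangent_basis S x v w \<and>
        ori x = {(a *\<^sub>R v + b *\<^sub>R w, c *\<^sub>R v + d *\<^sub>R w) |a b c d. a * d - b * c > 0}) \<and>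
     (\<forall>x\<in>S. \<exists>W e1 e2. openin (top_of_set S) W \<and> x \<in> W \<and>
        continuous_on W e1 \<and> continuous_on W e2 \<and> (\<forall>y\<in>W. (e1 y, e2 y) \<in> ori y))"

definition hermitian_form :: "complex \<times> complex \<Rightarrow> complex \<times> complex \<Rightarrow> complex" where
  "hermitian_form z w = fst z * cnj (fst w) + snd z * cnj (snd w)"

text \<open>The library's inner product, and hence its norm, are the Euclidean ones used here.\<close>

lemma Re_hermitian_form: "Re (hermitian_form z w) = z \<bullet> w"
  by (simp add: hermitian_form_def inner_prod_def inner_complex_def)

definition kaehler_form :: "complex \<times> complex \<Rightarrow> complex \<times> complex \<Rightarrow> real" where
  "kaehler_form z w = - Im (hermitian_form z w)"

definition lagrangian_surface :: "(complex \<times> complex) set \<Rightarrow> bool" where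
  "lagrangian_surface S \<longleftrightarrow> smooth_surface S \<and>
     (\<forall>x\<in>S. \<forall>v\<in>tangent_space S x. \<forall>w\<in>tangent_space S x. kaehler_form v w = 0)"

definition dz1_wedge_dz2 :: "complex \<times> complex \<Rightarrow> complex \<times> complex \<Rightarrow> complex" where
  "dz1_wedge_dz2 v w = fst v * snd w - snd v * fst w"

text \<open>Elements of $\mathbb{R}/2\pi\mathbb{Z}$ are given by representatives in $(-\pi,\pi]$, as for
  \<^const>\<open>Arg\<close>. The angle depends on the surface only through its orientation, which determines
  the oriented orthonormal tangent bases.\<close>

definition lagrangian_angle ::
    "(complex \<times> complex \<Rightarrow> ((complex \<times> complex) \<times> (complex \<times> complex)) set)
      \<Rightarrow> complex \<times> complex \<Rightarrow> real" where
  "lagrangian_angle ori x =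
     (THE \<beta>. - pi < \<beta> \<and> \<beta> \<le> pi \<and>
        (\<forall>(e1, e2) \<in> ori x. norm e1 = 1 \<and> norm e2 = 1 \<and> e1 \<bullet> e2 = 0 \<longrightarrow>
           cis \<beta> = dz1_wedge_dz2 e1 e2))"

end

theory Submission
  imports Defs
begin

text \<open>Put \<open>h = z\<^sub>1\<^bsup>p+1\<^esup> z\<^sub>2\<^bsup>q+1\<^esup>\<close>; only \<open>Re h = d > 0\<close> on the surface matters, not the value of \<open>d\<close>
  or \<open>\<lambda>\<close>. The surface is locally a graph over the two arguments: these determine
  \<open>\<bar>h\<bar> = d / cos (arg h)\<close>, and \<open>\<bar>h\<bar>\<^sup>2\<close> is a strictly increasing function of \<open>\<bar>z\<^sub>2\<bar>\<^sup>2 / (q + 1)\<close> along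
  the curve cut out by the first equation. The tangent planes are spanned by the Hamiltonian
  vector fields \<open>X = (\<i> z\<^sub>1 / (p+1), -\<i> z\<^sub>2 / (q+1))\<close> and \<open>Y = \<i> grad (Re h)\<close> of the two defining functions. These are
  Hermitian orthogonal, so the surface is Lagrangian, and \<open>(dz\<^sub>1 \<and> dz\<^sub>2) (Y, X)\<close> is a positive
  multiple of the conjugate of \<open>z\<^sub>1\<^bsup>p\<^esup> z\<^sub>2\<^bsup>q\<^esup>\<close>, which gives the angle for the orientation \<open>(Y, X)\<close>.\<close>

section \<open>Smooth functions\<close>

lemma k_smooth_on_cong_open:
  assumes "open U" "\<And>x. x \<in> U \<Longrightarrow> f x = g x" "k_smooth_on k U f"
  shows "k_smooth_on k U g"
  using assms(2,3)
proof (induction k arbitrary: f g)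
  case 0
  then show ?case by (metis continuous_on_cong k_smooth_on.simps(1))
next
  case (Suc k)
  have der: "(g has_derivative frechet_derivative f (at x)) (at x)" if "x \<in> U" for x
    using Suc.prems that has_derivative_transform_within_open[OF _ assms(1) that]
    by (metis frechet_derivative_works k_smooth_on.simps(2))
  have "frechet_derivative f (at x) = frechet_derivative g (at x)" if "x \<in> U" for x
    using frechet_derivative_at[OF der[OF that]] .
  with Suc.IH Suc.prems(2) have "k_smooth_on k U (\<lambda>x. frechet_derivative g (at x) v)" for v
    by (metis (no_types, lifting) k_smooth_on.simps(2))
  with der show ?case by (auto simp: differentiable_def)
qed

text \<open>Derivatives are unique, so an explicit formula may stand in for the one chosen by
  \<open>frechet_derivative\<close>.\<close>

lemma k_smooth_on_SucI:
  assumes "open U" "\<And>x. x \<in> U \<Longrightarrow> (f has_derivative f' x) (at x)"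
    "\<And>v. k_smooth_on k U (\<lambda>x. f' x v)"
  shows "k_smooth_on (Suc k) U f"
proof -
  have "frechet_derivative f (at x) = f' x" if "x \<in> U" for x
    using frechet_derivative_at[OF assms(2)[OF that]] by simp
  then have "k_smooth_on k U (\<lambda>x. frechet_derivative f (at x) v)" for v
    by (intro k_smooth_on_cong_open[OF assms(1) _ assms(3)[of v]]) auto
  with assms(2) show ?thesis by (auto simp: differentiable_def)
qed

lemma k_smooth_on_Pair:
  assumes "open U" "k_smooth_on k U f" "k_smooth_on k U g"
  shows "k_smooth_on k U (\<lambda>x. (f x, g x))"
  using assms(2,3)
proof (induction k arbitrary: f g)
  case 0
  then show ?case by (auto intro: continuous_intros)
next
  case (Suc k)
  show ?case
  proof (rule k_smooth_on_SucI[OF assms(1)])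
    show "((\<lambda>x. (f x, g x)) has_derivative
        (\<lambda>v. (frechet_derivative f (at x) v, frechet_derivative g (at x) v))) (at x)" if "x \<in> U" for x
      using Suc.prems that by (intro has_derivative_Pair) (auto simp: frechet_derivative_works)
  qed (use Suc in auto)
qed

text \<open>Differentiating only turns the direction \<open>v\<close> into \<open>L v\<close>, so
  the induction stays within this form. With \<open>L\<close> the identity it restricts charts to
  smaller open sets; with \<open>L\<close> a line it yields curves in the surface.\<close>

lemma k_smooth_on_affine:
  fixes L :: "'a::euclidean_space \<Rightarrow> 'c::euclidean_space"
  assumes "open U" "open U'" "bounded_linear L" "\<And>x. x \<in> U' \<Longrightarrow> a + L x \<in> U" "k_smooth_on k U f"
  shows "k_smooth_on k U' (\<lambda>x. f (a + L x))"
  using assms(5)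
proof (induction k arbitrary: f)
  case 0
  have "continuous_on U' (\<lambda>x. a + L x)"
    by (intro continuous_intros linear_continuous_on assms)
  with 0 show ?case using assms(4) by (auto intro!: continuous_on_compose2[of U f])
next
  case (Suc k)
  show ?case
  proof (rule k_smooth_on_SucI[OF assms(2)])
    show "((\<lambda>x. f (a + L x)) has_derivative (\<lambda>v. frechet_derivative f (at (a + L x)) (L v))) (at x)"
      if "x \<in> U'" for x
    proof -
      have "((\<lambda>x. a + L x) has_derivative L) (at x)"
        by (auto intro!: derivative_eq_intros bounded_linear_imp_has_derivative assms)
      from has_derivative_compose[OF this] show ?thesis
        using assms(4)[OF that] Suc.prems by (auto simp: frechet_derivative_works)
    qed
  qed (use Suc in auto)
qed

text \<open>This replaces a chain rule for iterated derivatives: it suffices to enclose a function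
  in a set of functions closed under differentiation.\<close>

lemma smooth_on_coinduct:
  assumes "open U" "f \<in> F"
    and "\<And>g. g \<in> F \<Longrightarrow> \<exists>g'. (\<forall>x\<in>U. (g has_derivative g' x) (at x)) \<and> (\<forall>v. (\<lambda>x. g' x v) \<in> F)"
  shows "smooth_on U f"
proof -
  have "k_smooth_on k U f" for k
    using assms(2)
  proof (induction k arbitrary: f)
    case 0
    with assms(3)[OF 0] show ?case
      by (auto intro!: continuous_at_imp_continuous_on intro: has_derivative_continuous)
  next
    case (Suc k)
    from assms(3)[OF Suc.prems] Suc.IH show ?case
      by (metis k_smooth_on_SucI[OF assms(1)])
  qed
  then show ?thesis by (simp add: smooth_on_def)
qed

text \<open>The unital algebra generated by \<open>G\<close>: polynomial expressions in its
  members.\<close>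

inductive_set fun_algebra :: "('a \<Rightarrow> 'b::real_normed_algebra_1) set \<Rightarrow> ('a \<Rightarrow> 'b) set" for G where
  gen: "g \<in> G \<Longrightarrow> g \<in> fun_algebra G"
| const: "(\<lambda>_. c) \<in> fun_algebra G"
| add: "f \<in> fun_algebra G \<Longrightarrow> g \<in> fun_algebra G \<Longrightarrow> (\<lambda>x. f x + g x) \<in> fun_algebra G"
| mult: "f \<in> fun_algebra G \<Longrightarrow> g \<in> fun_algebra G \<Longrightarrow> (\<lambda>x. f x * g x) \<in> fun_algebra G"

text \<open>By the sum and product rules only the generators need checking. Thus functions whose
  first derivatives are polynomials in the functions themselves are smooth.\<close>

lemma smooth_on_fun_algebra:
  assumes "open U" "f \<in> fun_algebra G"
    and G: "\<And>g. g \<in> G \<Longrightarrow> \<exists>g'. (\<forall>x\<in>U. (g has_derivative g' x) (at x)) \<and> (\<forall>v. (\<lambda>x. g' x v) \<in> fun_algebra G)"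
  shows "smooth_on U f"
proof (rule smooth_on_coinduct[OF assms(1,2)])
  fix g assume "g \<in> fun_algebra G"
  then show "\<exists>g'. (\<forall>x\<in>U. (g has_derivative g' x) (at x)) \<and> (\<forall>v. (\<lambda>x. g' x v) \<in> fun_algebra G)"
  proof induction
    case (gen g)
    then show ?case by (rule G)
  next
    case (const c)
    show ?case by (intro exI[of _ "\<lambda>_ _. 0"]) (auto intro: fun_algebra.intros)
  next
    case (add f g)
    then obtain f' g' where *: "\<And>x. x\<in>U \<Longrightarrow> (f has_derivative f' x) (at x)" "\<And>v. (\<lambda>x. f' x v) \<in> fun_algebra G"
      "\<And>x. x\<in>U \<Longrightarrow> (g has_derivative g' x) (at x)" "\<And>v. (\<lambda>x. g' x v) \<in> fun_algebra G" by blast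
    then show ?case
      by (intro exI[of _ "\<lambda>x v. f' x v + g' x v"]) (auto intro!: fun_algebra.add has_derivative_add)
  next
    case (mult f g)
    then obtain f' g' where *: "\<And>x. x\<in>U \<Longrightarrow> (f has_derivative f' x) (at x)" "\<And>v. (\<lambda>x. f' x v) \<in> fun_algebra G"
      "\<And>x. x\<in>U \<Longrightarrow> (g has_derivative g' x) (at x)" "\<And>v. (\<lambda>x. g' x v) \<in> fun_algebra G" by blast
    with mult.hyps show ?case
      by (intro exI[of _ "\<lambda>x v. f x * g' x v + f' x v * g x"])
        (auto intro!: fun_algebra.add fun_algebra.mult has_derivative_mult)
  qed
qed

section \<open>Charts of the level surface\<close>

locale radial_profile =
  fixes p q :: nat and c :: real
begin

text \<open>\<open>\<bar>h\<bar>\<^sup>2\<close> as a function of \<open>t = \<bar>z\<^sub>2\<bar>\<^sup>2 / (q + 1)\<close>, given that \<open>\<bar>z\<^sub>1\<bar>\<^sup>2 / (p + 1) = t + c\<close>.\<close>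

definition profile :: "real \<Rightarrow> real" where
  "profile t = ((real p + 1) * (t + c)) ^ Suc p * ((real q + 1) * t) ^ Suc q"

text \<open>The bound on \<open>t\<close> says that both squared moduli are positive; on that
  half-line \<open>profile\<close> is a bijection onto the positive reals.\<close>

definition profile_inv :: "real \<Rightarrow> real" where
  "profile_inv y = (THE t. t > max 0 (-c) \<and> profile t = y)"

lemma profile_strict_mono:
  assumes "max 0 (-c) \<le> s" "s < t"
  shows "profile s < profile t"
proof -
  have "((real p + 1) * (s + c)) ^ Suc p < ((real p + 1) * (t + c)) ^ Suc p"
    "((real q + 1) * s) ^ Suc q < ((real q + 1) * t) ^ Suc q"
    using assms by (intro power_strict_mono mult_strict_left_mono; simp)+
  then show ?thesis
    unfolding profile_def using assms by (intro mult_strict_mono zero_less_power mult_pos_pos zero_le_power mult_nonneg_nonneg) auto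
qed

text \<open>From this bound on, the first base is at least 1 and the second at least
  \<open>t\<close>, itself at least 1. The estimate supplies the upper endpoint for the intermediate
  value theorem.\<close>

lemma profile_ge:
  assumes "max 0 (-c) + 1 \<le> t"
  shows "t \<le> profile t"
proof -
  have "1 * 1 \<le> (real p + 1) * (t + c)"
    using assms by (intro mult_mono) auto
  then have 1: "1 ^ Suc p \<le> ((real p + 1) * (t + c)) ^ Suc p"
    by (intro power_mono) auto
  have "1 * t \<le> (real q + 1) * t"
    using assms by (intro mult_right_mono) auto
  moreover have "((real q + 1) * t) ^ 1 \<le> ((real q + 1) * t) ^ Suc q"
    using assms \<open>1 * t \<le> _\<close> by (intro power_increasing) auto
  ultimately have 2: "t \<le> ((real q + 1) * t) ^ Suc q"
    by (simp only: power_one_right mult_1_left)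
  have "1 ^ Suc p * t \<le> profile t"
    unfolding profile_def using assms 1 2 by (intro mult_mono) auto
  then show ?thesis by simp
qed

lemma profile_inv_unique:
  assumes "t > max 0 (-c)"
  shows "profile_inv (profile t) = t"
  unfolding profile_inv_def
proof (rule the_equality)
  show "s = t" if "max 0 (-c) < s \<and> profile s = profile t" for s
    using that assms profile_strict_mono[of s t] profile_strict_mono[of t s]
    by (cases s t rule: linorder_cases) auto
qed (use assms in auto)

lemma profile_inv_props:
  assumes "y > 0"
  shows "profile_inv y > max 0 (-c)" "profile (profile_inv y) = y"
proof -
  define t0 where "t0 = max 0 (-c)"
  \<comment> \<open>At \<open>t0\<close> one of the two bases vanishes, and both exponents are
    positive.\<close>
  have "profile t0 = 0" by (auto simp: profile_def t0_def max_def)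
  moreover have "y \<le> profile (t0 + 1 + y)"
    using profile_ge[of "t0 + 1 + y"] assms by (auto simp: t0_def)
  moreover have "continuous_on {t0..t0+1+y} profile"
    unfolding profile_def by (intro continuous_intros)
  ultimately obtain t where "t0 \<le> t" "profile t = y"
    using IVT'[of profile t0 y "t0+1+y"] assms by (auto simp: t0_def simp del: max.bounded_iff)
  with \<open>profile t0 = 0\<close> assms have "t > t0" by (cases "t = t0") auto
  then show "profile_inv y > max 0 (-c)" "profile (profile_inv y) = y"
    using profile_inv_unique[of t] \<open>profile t = y\<close> by (auto simp: t0_def)
qed

text \<open>The derivative is written as value times logarithmic derivative, so that at
  \<open>profile_inv y\<close> the value becomes \<open>y\<close>.\<close>

lemma profile_has_derivative:
  assumes "t > max 0 (-c)"
  shows "(profile has_real_derivative profile t * ((real p + 1) / (t + c) + (real q + 1) / t)) (at t)"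
proof -
  have "t > 0" "t + c > 0" using assms by auto
  have pow: "((\<lambda>t. ((real n + 1) * (t + e)) ^ Suc n) has_real_derivative
      ((real n + 1) * (t + e)) ^ Suc n * ((real n + 1) / (t + e))) (at t)" if "t + e > 0" for n e
    by (rule DERIV_cong[OF DERIV_power_Suc[where D = "real n + 1"]])
      (use that in \<open>auto intro!: derivative_eq_intros simp: field_simps\<close>)
  have alg: "(A * a) * B + (B * b) * A = A * B * (a + b)" for A B a b :: real
    by algebra
  from pow[of 0 q] \<open>t > 0\<close> have "((\<lambda>t. ((real q + 1) * t) ^ Suc q) has_real_derivative
      ((real q + 1) * t) ^ Suc q * ((real q + 1) / t)) (at t)"
    by (simp only: add_0_right)
  from DERIV_mult[OF pow[OF \<open>t + c > 0\<close>, of p] this] show ?thesis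
    unfolding profile_def alg .
qed

lemma profile_inv_has_derivative:
  assumes "y > 0"
  shows "(profile_inv has_real_derivative inverse (y * ((real p + 1) / (profile_inv y + c) + (real q + 1) / profile_inv y))) (at y)"
proof (rule DERIV_inverse_function[where f = profile and a = 0 and b = "y + 1"])
  have *: "profile_inv y > max 0 (-c)" "profile (profile_inv y) = y" using profile_inv_props[OF assms] by auto
  show "(profile has_real_derivative y * ((real p + 1) / (profile_inv y + c) + (real q + 1) / profile_inv y)) (at (profile_inv y))"
    using profile_has_derivative[OF *(1)] * by simp
  have "profile_inv y + c > 0" "profile_inv y > 0"
    using * by auto
  then have "(real p + 1) / (profile_inv y + c) > 0" "(real q + 1) / profile_inv y > 0"
    by simp_all
  then have "(real p + 1) / (profile_inv y + c) + (real q + 1) / profile_inv y > 0"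
    by (rule add_pos_pos)
  then show "y * ((real p + 1) / (profile_inv y + c) + (real q + 1) / profile_inv y) \<noteq> 0"
    using assms by simp
  have "isCont profile_inv (profile (profile_inv y))"
  proof (rule isCont_inverse_function2[where f = profile and x = "profile_inv y"])
    \<comment> \<open>The left end lies halfway down to the threshold, so \<open>profile_inv\<close>
      inverts \<open>profile\<close> on the whole interval.\<close>
    show "(max 0 (-c) + profile_inv y) / 2 < profile_inv y" "profile_inv y < profile_inv y + 1" using * by auto
    show "profile_inv (profile z) = z" if "(max 0 (-c) + profile_inv y) / 2 \<le> z" for z
      using that * by (intro profile_inv_unique) auto
    show "isCont profile z" for z
      unfolding profile_def by (intro continuous_intros)
  qed
  then show "isCont profile_inv y" using * by simp
qed (use assms profile_inv_props in auto)

end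

text \<open>A square root halves the logarithmic derivative. Stating it this way avoids dividing by
  the root and keeps the derivatives of \<open>F1\<close> and \<open>F2\<close> polynomial.\<close>

lemma sqrt_has_derivative_log:
  assumes "g u > 0" "(g has_derivative (\<lambda>v. 2 * g u * g' v)) (at u)"
  shows "((\<lambda>u. sqrt (g u)) has_derivative (\<lambda>v. sqrt (g u) * g' v)) (at u)"
  using assms by (auto intro!: derivative_eq_intros simp: field_simps)

section \<open>Parametrization of the surface by the two arguments\<close>

locale level_surface = radial_profile +
  fixes d :: real
  assumes d_pos: "d > 0"
begin

definition level :: "(complex \<times> complex) set" where
  "level = {z. (norm (fst z))\<^sup>2 / (real p + 1) - (norm (snd z))\<^sup>2 / (real q + 1) = c \<and>
     Re (fst z ^ Suc p * snd z ^ Suc q) = d}"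

definition phase :: "real \<times> real \<Rightarrow> real" where
  "phase u = (real p + 1) * fst u + (real q + 1) * snd u"

text \<open>\<open>T\<close> is the value of \<open>\<bar>z\<^sub>2\<bar>\<^sup>2 / (q + 1)\<close> at the point of the surface with arguments \<open>u\<close>;
  the phase \<open>Arg (z\<^sub>1\<^bsup>p+1\<^esup> z\<^sub>2\<^bsup>q+1\<^esup>)\<close> and \<open>d\<close> fix \<open>\<bar>z\<^sub>1\<^bsup>p+1\<^esup> z\<^sub>2\<^bsup>q+1\<^esup>\<bar> = d / cos (phase u)\<close>.\<close>

definition T :: "real \<times> real \<Rightarrow> real" where
  "T u = profile_inv ((d / cos (phase u))\<^sup>2)"

text \<open>The reciprocal of the denominator in the derivative of \<open>T\<close>. Treated as a
  function of its own, it makes that derivative polynomial in \<open>T\<close>, \<open>W\<close> and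
  \<open>tan (phase u)\<close>, up to the linear factor \<open>phase v\<close>.\<close>

definition W :: "real \<times> real \<Rightarrow> real" where
  "W u = 1 / ((real p + 1) * T u + (real q + 1) * (T u + c))"

definition F1 :: "real \<times> real \<Rightarrow> complex" where
  "F1 u = of_real (sqrt ((real p + 1) * (T u + c))) * cis (fst u)"

definition F2 :: "real \<times> real \<Rightarrow> complex" where
  "F2 u = of_real (sqrt ((real q + 1) * T u)) * cis (snd u)"

text \<open>Since \<open>d > 0\<close>, the phase of \<open>h\<close> must have positive cosine.
  Arguments are real numbers here, so \<open>F\<close> is periodic on this set with period
  \<open>2 * pi\<close> in each variable.\<close>

definition chart_dom :: "(real \<times> real) set" where
  "chart_dom = {u. cos (phase u) > 0}"

lemma open_chart_dom: "open chart_dom"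
  unfolding chart_dom_def phase_def by (intro open_Collect_less continuous_intros)

lemma phase_has_derivative: "(phase has_derivative phase) (at u)"
  unfolding phase_def by (auto intro!: derivative_eq_intros)

lemma T_props:
  assumes "u \<in> chart_dom"
  shows "T u > 0" "T u + c > 0" "profile (T u) = (d / cos (phase u))\<^sup>2"
  using profile_inv_props[of "(d / cos (phase u))\<^sup>2"] assms d_pos by (auto simp: T_def chart_dom_def)

text \<open>\<open>(d / cos s)^2\<close> has logarithmic derivative \<open>2 * tan s\<close>; the
  chain rule through \<open>profile_inv\<close> then cancels the value \<open>y\<close>.\<close>

lemma T_has_derivative:
  assumes "u \<in> chart_dom"
  shows "(T has_derivative (\<lambda>v. 2 * tan (phase u) * T u * (T u + c) * W u * phase v)) (at u)"
proof -
  have cos: "cos (phase u) > 0" using assms by (simp add: chart_dom_def)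
  define y where "y = (d / cos (phase u))\<^sup>2"
  have y: "y > 0" using cos d_pos by (simp add: y_def)
  have "((\<lambda>s. (d / cos s)\<^sup>2) has_real_derivative 2 * y * tan (phase u)) (at (phase u))"
    using cos by (auto intro!: derivative_eq_intros simp: y_def tan_def field_simps power2_eq_square)
  from DERIV_chain2[OF profile_inv_has_derivative[OF y, unfolded y_def] this]
  have "((\<lambda>s. profile_inv ((d / cos s)\<^sup>2)) has_real_derivative
    inverse (y * ((real p + 1) / (T u + c) + (real q + 1) / T u)) * (2 * y * tan (phase u))) (at (phase u))"
    by (simp add: T_def y_def)
  moreover have "inverse (y * ((real p + 1) / (T u + c) + (real q + 1) / T u)) * (2 * y * tan (phase u))
      = 2 * tan (phase u) * T u * (T u + c) * W u"
  proof -
    have "(real p + 1) / (T u + c) + (real q + 1) / T u = 1 / (T u * (T u + c) * W u)"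
      using T_props[OF assms] unfolding W_def by (simp add: add_frac_eq)
    then show ?thesis using y by simp
  qed
  ultimately have "((\<lambda>s. profile_inv ((d / cos s)\<^sup>2)) has_derivative
      (\<lambda>s. 2 * tan (phase u) * T u * (T u + c) * W u * s)) (at (phase u))"
    by (simp only: has_field_derivative_def)
  from has_derivative_compose[OF phase_has_derivative this] show ?thesis
    by (simp add: T_def[abs_def])
qed

lemma W_has_derivative:
  assumes "u \<in> chart_dom"
  shows "(W has_derivative (\<lambda>v. - (real p + real q + 2) * W u * W u *
    (2 * tan (phase u) * T u * (T u + c) * W u * phase v))) (at u)"
proof -
  have "(real p + 1) * T u > 0" "(real q + 1) * (T u + c) > 0"
    using T_props[OF assms] by simp_all
  then have "(real p + 1) * T u + (real q + 1) * (T u + c) > 0"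
    by (rule add_pos_pos)
  then have nz: "(real p + 1) * T u + (real q + 1) * (T u + c) \<noteq> 0"
    by simp
  note T' = T_has_derivative[OF assms]
  have "((\<lambda>u. (real p + 1) * T u + (real q + 1) * (T u + c)) has_derivative
      (\<lambda>v. (real p + real q + 2) * (2 * tan (phase u) * T u * (T u + c) * W u * phase v))) (at u)"
    by (rule has_derivative_eq_rhs[OF has_derivative_add[OF has_derivative_mult_right[OF T']
            has_derivative_mult_right[OF has_derivative_add[OF T' has_derivative_const]]]])
      (simp add: fun_eq_iff algebra_simps)
  from Deriv.has_derivative_inverse[OF nz this] show ?thesis
    unfolding W_def[abs_def, folded inverse_eq_divide]
    by (rule has_derivative_eq_rhs) (simp only: fun_eq_iff mult_ac mult_minus_left mult_minus_right, simp)
qed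

lemma tan_phase_has_derivative:
  assumes "u \<in> chart_dom"
  shows "((\<lambda>u. tan (phase u)) has_derivative (\<lambda>v. (1 + tan (phase u) * tan (phase u)) * phase v)) (at u)"
proof -
  have "cos (phase u) \<noteq> 0" using assms by (simp add: chart_dom_def)
  moreover from this have "inverse ((cos (phase u))\<^sup>2) = 1 + tan (phase u) * tan (phase u)"
    using tan_sec[of "phase u"] by (simp add: power2_eq_square)
  ultimately have "(tan has_derivative (\<lambda>s. (1 + tan (phase u) * tan (phase u)) * s)) (at (phase u))"
    using DERIV_tan[of "phase u"] by (simp add: has_field_derivative_def)
  from has_derivative_compose[OF phase_has_derivative this] show ?thesis by simp
qed

text \<open>In the logarithmic derivative the real part is the radial rate, half of that of
  \<open>T u + c\<close>, and the imaginary part is the angular velocity.\<close>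

lemma F1_has_derivative:
  assumes "u \<in> chart_dom"
  shows "(F1 has_derivative (\<lambda>v. F1 u * (of_real (tan (phase u) * T u * W u * phase v) + \<i> * of_real (fst v)))) (at u)"
proof -
  have "((\<lambda>u. sqrt ((real p + 1) * (T u + c))) has_derivative
      (\<lambda>v. sqrt ((real p + 1) * (T u + c)) * (tan (phase u) * T u * W u * phase v))) (at u)"
    using T_props[OF assms]
    by (intro sqrt_has_derivative_log) (auto intro!: derivative_eq_intros T_has_derivative assms)
  from has_derivative_mult[OF has_derivative_of_real[OF this]
      has_derivative_cis[OF has_derivative_fst[OF has_derivative_ident]]]
  show ?thesis
    unfolding F1_def[abs_def]
    by (rule has_derivative_eq_rhs) (simp add: fun_eq_iff scaleR_conv_of_real ring_distribs mult_ac)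
qed

lemma F2_has_derivative:
  assumes "u \<in> chart_dom"
  shows "(F2 has_derivative (\<lambda>v. F2 u * (of_real (tan (phase u) * (T u + c) * W u * phase v) + \<i> * of_real (snd v)))) (at u)"
proof -
  have "((\<lambda>u. sqrt ((real q + 1) * T u)) has_derivative
      (\<lambda>v. sqrt ((real q + 1) * T u) * (tan (phase u) * (T u + c) * W u * phase v))) (at u)"
    using T_props[OF assms]
    by (intro sqrt_has_derivative_log) (auto intro!: derivative_eq_intros T_has_derivative assms)
  from has_derivative_mult[OF has_derivative_of_real[OF this]
      has_derivative_cis[OF has_derivative_snd[OF has_derivative_ident]]]
  show ?thesis
    unfolding F2_def[abs_def]
    by (rule has_derivative_eq_rhs) (simp add: fun_eq_iff scaleR_conv_of_real ring_distribs mult_ac)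
qed

definition F :: "real \<times> real \<Rightarrow> complex \<times> complex" where
  "F u = (F1 u, F2 u)"

lemma smooth_on_F: "smooth_on chart_dom F"
proof -
  \<comment> \<open>These five functions are chosen so that each has derivatives polynomial in all
    of them; they are made complex-valued to lie in one algebra.\<close>
  define G where "G = {\<lambda>u. complex_of_real (T u), \<lambda>u. complex_of_real (W u),
    \<lambda>u. complex_of_real (tan (phase u)), F1, F2}"
  have gens: "(\<lambda>u. complex_of_real (T u)) \<in> fun_algebra G" "(\<lambda>u. complex_of_real (W u)) \<in> fun_algebra G"
    "(\<lambda>u. complex_of_real (tan (phase u))) \<in> fun_algebra G" "F1 \<in> fun_algebra G" "F2 \<in> fun_algebra G"
    by (auto intro: fun_algebra.gen simp: G_def)
  note alg = gens fun_algebra.const fun_algebra.add fun_algebra.mult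
  have "\<exists>g'. (\<forall>x\<in>chart_dom. (g has_derivative g' x) (at x)) \<and> (\<forall>v. (\<lambda>x. g' x v) \<in> fun_algebra G)"
    if "g \<in> G" for g
  proof -
    from that consider "g = (\<lambda>u. complex_of_real (T u))" | "g = (\<lambda>u. complex_of_real (W u))"
      | "g = (\<lambda>u. complex_of_real (tan (phase u)))" | "g = F1" | "g = F2"
      unfolding G_def by blast
    then show ?thesis
    proof cases
      case 1
      show ?thesis unfolding 1
        by (intro exI conjI ballI allI, rule has_derivative_of_real[OF T_has_derivative], assumption)
          (simp only: of_real_mult of_real_add, intro alg)
    next
      case 2
      show ?thesis unfolding 2
        by (intro exI conjI ballI allI, rule has_derivative_of_real[OF W_has_derivative], assumption)
          (simp only: of_real_mult of_real_add, intro alg)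
    next
      case 3
      show ?thesis unfolding 3
        by (intro exI conjI ballI allI, rule has_derivative_of_real[OF tan_phase_has_derivative], assumption)
          (simp only: of_real_mult of_real_add, intro alg)
    next
      case 4
      show ?thesis unfolding 4
        by (intro exI conjI ballI allI, rule F1_has_derivative, assumption)
          (simp only: of_real_mult of_real_add, intro alg)
    next
      case 5
      show ?thesis unfolding 5
        by (intro exI conjI ballI allI, rule F2_has_derivative, assumption)
          (simp only: of_real_mult of_real_add, intro alg)
    qed
  qed
  then have "smooth_on chart_dom F1" "smooth_on chart_dom F2"
    using smooth_on_fun_algebra[OF open_chart_dom] gens(4,5) by blast+
  then show ?thesis
    unfolding smooth_on_def F_def[abs_def] by (simp add: k_smooth_on_Pair open_chart_dom)
qed

text \<open>By De Moivre, \<open>h\<close> has argument \<open>phase u\<close> and modulus the root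
  of \<open>profile (T u)\<close>, which is \<open>d / cos (phase u)\<close>.\<close>

lemma F_in_level:
  assumes "u \<in> chart_dom"
  shows "F u \<in> level"
proof -
  define A B where "A = (real p + 1) * (T u + c)" and "B = (real q + 1) * T u"
  have pos: "A > 0" "B > 0" using T_props[OF assms] by (auto simp: A_def B_def)
  have cos: "cos (phase u) > 0" using assms by (simp add: chart_dom_def)
  have "F1 u ^ Suc p * F2 u ^ Suc q = rcis (sqrt A ^ Suc p * sqrt B ^ Suc q) (phase u)"
    unfolding F1_def F2_def A_def[symmetric] B_def[symmetric] rcis_def[symmetric] DeMoivre2 rcis_mult
    by (simp add: phase_def add_ac)
  moreover have "sqrt A ^ Suc p * sqrt B ^ Suc q = sqrt (profile (T u))"
    unfolding real_sqrt_power[symmetric] real_sqrt_mult[symmetric] profile_def A_def B_def ..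
  then have "sqrt A ^ Suc p * sqrt B ^ Suc q = d / cos (phase u)"
    using T_props[OF assms] d_pos cos by simp
  ultimately have "Re (F1 u ^ Suc p * F2 u ^ Suc q) = d"
    using cos by (simp del: power_Suc)
  moreover have "(norm (F1 u))\<^sup>2 = A" "(norm (F2 u))\<^sup>2 = B"
    using pos by (simp_all add: F1_def F2_def A_def B_def norm_mult)
  ultimately show ?thesis
    unfolding level_def F_def by (simp add: A_def B_def)
qed

text \<open>The arguments fix the modulus of \<open>h\<close> through \<open>Re h = d\<close>, hence
  the profile value, and \<open>profile\<close> is injective. Arbitrary arguments \<alpha>, \<beta>
  are allowed because charts use shifted branches.\<close>

lemma F_of_polar:
  assumes "z \<in> level" "fst z = rcis (norm (fst z)) \<alpha>" "snd z = rcis (norm (snd z)) \<beta>"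
  shows "(\<alpha>, \<beta>) \<in> chart_dom" "F (\<alpha>, \<beta>) = z"
proof -
  define r1 r2 \<phi> where "r1 = norm (fst z)" and "r2 = norm (snd z)" and "\<phi> = phase (\<alpha>, \<beta>)"
  note z = assms(2,3)[folded r1_def r2_def]
  have h: "fst z ^ Suc p * snd z ^ Suc q = rcis (r1 ^ Suc p * r2 ^ Suc q) \<phi>"
    by (subst z(1), subst z(2), unfold DeMoivre2 rcis_mult) (simp add: \<phi>_def phase_def add_ac)
  have d: "r1 ^ Suc p * r2 ^ Suc q * cos \<phi> = d"
    and c: "r1\<^sup>2 / (real p + 1) - r2\<^sup>2 / (real q + 1) = c"
    using assms(1)
    unfolding level_def mem_Collect_eq h Re_rcis r1_def[symmetric] r2_def[symmetric] by blast+
  have r_nonneg: "r1 \<ge> 0" "r2 \<ge> 0" by (auto simp: r1_def r2_def)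
  \<comment> \<open>The moduli are nonnegative and the product is \<open>d > 0\<close>.\<close>
  have cos: "cos \<phi> > 0"
    using d d_pos r_nonneg by (metis mult_nonneg_nonneg zero_le_power zero_less_mult_pos not_less_iff_gr_or_eq mult_zero_left order_le_less)
  have r: "r1 > 0" "r2 > 0"
    using d d_pos r_nonneg by (auto simp: order_le_less)
  define t where "t = r2\<^sup>2 / (real q + 1)"
  have t: "(real q + 1) * t = r2\<^sup>2" "(real p + 1) * (t + c) = r1\<^sup>2"
    unfolding c[symmetric] t_def by simp_all
  have "t > max 0 (- c)"
  proof -
    have "t > 0" "r1\<^sup>2 / (real p + 1) > 0" using r by (simp_all add: t_def)
    then show ?thesis using c by (simp add: t_def)
  qed
  moreover have "profile t = (d / cos \<phi>)\<^sup>2"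
    using cos unfolding profile_def t d[symmetric] by (simp add: power_mult_distrib power2_eq_square del: power_Suc)
  ultimately have T: "T (\<alpha>, \<beta>) = t"
    unfolding T_def \<phi>_def[symmetric] using profile_inv_unique by metis
  show "(\<alpha>, \<beta>) \<in> chart_dom" using cos by (simp add: chart_dom_def \<phi>_def)
  show "F (\<alpha>, \<beta>) = z"
    unfolding F_def F1_def F2_def T t using z r_nonneg by (simp add: rcis_def prod_eq_iff)
qed

lemma level_nonzero:
  assumes "z \<in> level"
  shows "fst z \<noteq> 0" "snd z \<noteq> 0"
  using assms d_pos by (auto simp: level_def)

end

section \<open>Branches of the argument on slit planes\<close>

lemma Arg_rcis_eq:
  assumes "r > 0" "- pi < a" "a \<le> pi"
  shows "Arg (rcis r a) = a"
  using assms by (intro cis_Arg_unique) (auto simp: rcis_def norm_mult sgn_eq)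

lemma Arg_eq_pi_imp_nonpos_Reals:
  assumes "Arg z = pi"
  shows "z \<in> \<real>\<^sub>\<le>\<^sub>0"
proof -
  have "z = rcis (norm z) pi" using assms rcis_cmod_Arg[of z] by simp
  then have "z = of_real (- norm z)" by (simp add: rcis_def)
  then show ?thesis by (metis neg_le_0_iff_le nonpos_Reals_of_real_iff norm_ge_zero)
qed

lemma Arg_nonpos_Reals:
  assumes "z \<in> \<real>\<^sub>\<le>\<^sub>0" "z \<noteq> 0"
  shows "Arg z = pi"
proof -
  from assms obtain r where r: "z = of_real r" "r \<le> 0"
    by (auto elim: nonpos_Reals_cases)
  with assms(2) have "z = rcis (- r) pi" "- r > 0" by (auto simp: rcis_def)
  then show ?thesis by (metis Arg_rcis_eq minus_less_iff order_refl pi_gt_zero neg_less_0_iff_less less_trans)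
qed

text \<open>\<open>a + Arg (z * cis (- a))\<close> is the branch of the argument with values within
  \<open>pi\<close> of \<open>a\<close>, continuous off the ray opposite to the direction
  \<open>a\<close>.\<close>

lemma slit_plane_angle:
  assumes "r > 0" "\<bar>t - a\<bar> < pi"
  shows "rcis r t * cis (- a) \<notin> \<real>\<^sub>\<le>\<^sub>0" "a + Arg (rcis r t * cis (- a)) = t"
proof -
  have eq: "rcis r t * cis (- a) = rcis r (t - a)"
    by (simp add: rcis_def cis_mult)
  have Arg: "Arg (rcis r (t - a)) = t - a"
    using assms by (intro Arg_rcis_eq) auto
  show "a + Arg (rcis r t * cis (- a)) = t"
    unfolding eq Arg by simp
  show "rcis r t * cis (- a) \<notin> \<real>\<^sub>\<le>\<^sub>0"
    unfolding eq using assms Arg Arg_nonpos_Reals[of "rcis r (t - a)"] by auto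
qed

text \<open>Off the cut \<open>Arg\<close> never takes the value \<open>pi\<close>, so the bound is
  strict on both sides.\<close>

lemma slit_plane_polar:
  assumes "z * cis (- a) \<notin> \<real>\<^sub>\<le>\<^sub>0"
  defines "t \<equiv> a + Arg (z * cis (- a))"
  shows "\<bar>t - a\<bar> < pi" "z = rcis (norm z) t"
proof -
  show "\<bar>t - a\<bar> < pi"
    using Arg_bounded[of "z * cis (- a)"] Arg_eq_pi_imp_nonpos_Reals assms(1)
    by (force simp: t_def abs_less_iff order_le_less)
  have "z * cis (- a) = rcis (norm z) (t - a)"
    using rcis_cmod_Arg[of "z * cis (- a)"] by (simp add: t_def norm_mult)
  then have "z * cis (- a) * cis a = rcis (norm z) (t - a) * cis a" by simp
  then show "z = rcis (norm z) t"
    by (simp add: rcis_def cis_mult mult.assoc)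
qed

lemma complex_mult_cancel_imaginary:
  fixes z :: complex
  assumes "z \<noteq> 0" "z * (of_real a + \<i> * of_real b) = z * (of_real a' + \<i> * of_real b')"
  shows "b = b'"
proof -
  have "of_real a + \<i> * of_real b = (of_real a' + \<i> * of_real b' :: complex)"
    using assms by (metis mult_left_cancel)
  then show ?thesis by (simp add: complex_eq_iff)
qed

section \<open>Smoothness and tangent planes of the level surface\<close>

context level_surface
begin

definition DF :: "real \<times> real \<Rightarrow> real \<times> real \<Rightarrow> complex \<times> complex" where
  "DF u v = (F1 u * (of_real (tan (phase u) * T u * W u * phase v) + \<i> * of_real (fst v)),
    F2 u * (of_real (tan (phase u) * (T u + c) * W u * phase v) + \<i> * of_real (snd v)))"

lemma F_has_derivative:
  assumes "u \<in> chart_dom"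
  shows "(F has_derivative DF u) (at u)"
  unfolding F_def[abs_def] DF_def[abs_def] by (intro has_derivative_Pair F1_has_derivative F2_has_derivative assms)

lemma F1_F2_nonzero:
  assumes "u \<in> chart_dom"
  shows "F1 u \<noteq> 0" "F2 u \<noteq> 0"
  using level_nonzero[OF F_in_level[OF assms]] by (auto simp: F_def)

text \<open>Dividing the components of \<open>DF u v\<close> by \<open>F1 u\<close> and
  \<open>F2 u\<close> gives imaginary parts \<open>fst v\<close> and \<open>snd v\<close>, which
  recover \<open>v\<close>.\<close>

lemma inj_frechet_derivative_F:
  assumes "u \<in> chart_dom"
  shows "inj (frechet_derivative F (at u))"
  unfolding frechet_derivative_at[OF F_has_derivative[OF assms], symmetric]
  unfolding DF_def using F1_F2_nonzero[OF assms] complex_mult_cancel_imaginary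
  by (intro injI) (metis prod.inject prod_eqI)

lemma F_rcis:
  assumes "u \<in> chart_dom"
  shows "\<exists>r s. r > 0 \<and> s > 0 \<and> F u = (rcis r (fst u), rcis s (snd u))"
  using T_props[OF assms] by (auto simp: F_def F1_def F2_def rcis_def intro!: exI[of _ "sqrt _"])

lemma smooth_surface_level: "smooth_surface level"
  unfolding smooth_surface_def
proof
  fix z assume z: "z \<in> level"
  define a b where "a = Arg (fst z)" and "b = Arg (snd z)"
  \<comment> \<open>Periodicity makes \<open>F\<close> non-injective on \<open>chart_dom\<close>;
    keeping the arguments within \<open>pi\<close> of those of \<open>z\<close> singles out one
    branch, which \<open>g\<close> reads off on the slit planes of \<open>V\<close>.\<close>
  define U where "U = chart_dom \<inter> {u. \<bar>fst u - a\<bar> < pi \<and> \<bar>snd u - b\<bar> < pi}"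
  define V :: "(complex \<times> complex) set" where
    "V = {z. fst z * cis (- a) \<in> - \<real>\<^sub>\<le>\<^sub>0} \<inter> {z. snd z * cis (- b) \<in> - \<real>\<^sub>\<le>\<^sub>0}"
  define g where "g z = (a + Arg (fst z * cis (- a)), b + Arg (snd z * cis (- b)))" for z
  have "open U"
    unfolding U_def
    by (intro open_Int open_chart_dom open_Collect_conj open_Collect_less continuous_intros)
  have "open {z :: complex \<times> complex. fst z * cis (- a) \<in> - \<real>\<^sub>\<le>\<^sub>0}"
       "open {z :: complex \<times> complex. snd z * cis (- b) \<in> - \<real>\<^sub>\<le>\<^sub>0}"
    by (intro open_vimage[unfolded vimage_def] continuous_intros open_Compl closed_nonpos_Reals_complex)+
  then have "open V" unfolding V_def by (rule open_Int)
  have polar: "(g y \<in> U \<and> F (g y) = y)" if "y \<in> level" "y \<in> V" for y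
  proof -
    have V: "fst y * cis (- a) \<notin> \<real>\<^sub>\<le>\<^sub>0" "snd y * cis (- b) \<notin> \<real>\<^sub>\<le>\<^sub>0"
      using that(2) by (auto simp: V_def)
    show ?thesis
      using F_of_polar[OF that(1) slit_plane_polar(2)[OF V(1)] slit_plane_polar(2)[OF V(2)]]
        slit_plane_polar(1)[OF V(1)] slit_plane_polar(1)[OF V(2)]
      by (simp add: g_def U_def)
  qed
  have angles: "F u \<in> V \<and> g (F u) = u" if "u \<in> U" for u
  proof -
    from that obtain r s where F: "F u = (rcis r (fst u), rcis s (snd u))" "r > 0" "s > 0"
      using F_rcis[of u] by (auto simp: U_def)
    have "\<bar>fst u - a\<bar> < pi" "\<bar>snd u - b\<bar> < pi" using that by (auto simp: U_def)
    from slit_plane_angle[OF F(2) this(1)] slit_plane_angle[OF F(3) this(2)] show ?thesis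
      unfolding V_def g_def F(1) by simp
  qed
  have "homeomorphism U (level \<inter> V) F g"
  proof
    show "continuous_on U F"
      by (intro continuous_at_imp_continuous_on ballI has_derivative_continuous[OF F_has_derivative])
        (simp add: U_def)
    show "continuous_on (level \<inter> V) g"
      unfolding g_def by (intro continuous_intros) (auto simp: V_def)
    show "F ` U \<subseteq> level \<inter> V"
      using angles F_in_level by (auto simp: U_def)
  qed (use polar angles in auto)
  \<comment> \<open>Restriction to \<open>U\<close> is composition with the identity as affine
    map.\<close>
  moreover have "smooth_on U F"
    using smooth_on_F k_smooth_on_affine[OF open_chart_dom \<open>open U\<close> bounded_linear_ident, of 0]
    unfolding smooth_on_def by (force simp: U_def)
  moreover have "z \<in> V"
    using level_nonzero[OF z] Arg_nonpos_Reals slit_plane_angle(1)[of "norm (fst z)" a a]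
      slit_plane_angle(1)[of "norm (snd z)" b b]
    by (simp add: V_def a_def b_def rcis_cmod_Arg)
  ultimately show "\<exists>(U :: (real \<times> real) set) V f g. open U \<and> open V \<and> z \<in> V \<and>
      homeomorphism U (level \<inter> V) f g \<and> smooth_on U f \<and> (\<forall>u\<in>U. inj (frechet_derivative f (at u)))"
    using \<open>open U\<close> \<open>open V\<close> inj_frechet_derivative_F U_def by blast
qed

text \<open>The kernel of the differentials of the two defining functions.\<close>

definition Tan :: "complex \<times> complex \<Rightarrow> (complex \<times> complex) set" where
  "Tan z = {v. (fst z \<bullet> fst v) / (real p + 1) = (snd z \<bullet> snd v) / (real q + 1) \<and>
     Re (of_nat (Suc p) * fst z ^ p * snd z ^ Suc q * fst v
       + of_nat (Suc q) * fst z ^ Suc p * snd z ^ q * snd v) = 0}"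

lemma Tan_lincomb:
  assumes "v \<in> Tan z" "w \<in> Tan z"
  shows "a *\<^sub>R v + b *\<^sub>R w \<in> Tan z"
proof -
  define L where "L v = of_nat (Suc p) * fst z ^ p * snd z ^ Suc q * fst v
       + of_nat (Suc q) * fst z ^ Suc p * snd z ^ q * snd v" for v
  have "L (a *\<^sub>R v + b *\<^sub>R w) = a *\<^sub>R L v + b *\<^sub>R L w"
    by (simp add: L_def scaleR_conv_of_real ring_distribs mult_ac)
  then have "Re (L (a *\<^sub>R v + b *\<^sub>R w)) = a * Re (L v) + b * Re (L w)" by simp
  with assms show ?thesis
    unfolding Tan_def L_def[symmetric]
    by (simp add: inner_add_right add_divide_distrib times_divide_eq_right[symmetric] del: times_divide_eq_right)
qed

text \<open>Without angular part the vector is radial, with real rates \<open>s\<close> and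
  \<open>t\<close>. Constancy of \<open>Re h\<close> forces opposite signs unless both vanish, while
  the other equation forces equal signs.\<close>

lemma Tan_eq_0:
  assumes z: "z \<in> level" and v: "v \<in> Tan z" and "Im (fst v / fst z) = 0" "Im (snd v / snd z) = 0"
  shows "v = 0"
proof -
  note nz = level_nonzero[OF z]
  obtain s t where st: "fst v = of_real s * fst z" "snd v = of_real t * snd z"
    using assms(3,4) nz by (metis complex_is_Real_iff Reals_cases nonzero_divide_eq_eq)
  \<comment> \<open>Along a radial vector the derivative of \<open>h\<close> is a real multiple of
    \<open>h\<close>, whose real part \<open>d\<close> is nonzero.\<close>
  have "of_nat (Suc p) * fst z ^ p * snd z ^ Suc q * fst v + of_nat (Suc q) * fst z ^ Suc p * snd z ^ q * snd v
      = of_real ((real p + 1) * s + (real q + 1) * t) * (fst z ^ Suc p * snd z ^ Suc q)"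
    by (simp add: st algebra_simps)
  moreover have "Re (of_nat (Suc p) * fst z ^ p * snd z ^ Suc q * fst v
      + of_nat (Suc q) * fst z ^ Suc p * snd z ^ q * snd v) = 0"
    using v unfolding Tan_def mem_Collect_eq by blast
  moreover have "Re (fst z ^ Suc p * snd z ^ Suc q) = d"
    using z unfolding level_def mem_Collect_eq by blast
  ultimately have "((real p + 1) * s + (real q + 1) * t) * d = 0"
    by (simp only: scaleR_conv_of_real[symmetric] scaleR_complex.sel)
  then have 1: "(real p + 1) * s + (real q + 1) * t = 0"
    using d_pos by simp
  have "(fst z \<bullet> fst z) * s / (real p + 1) = (snd z \<bullet> snd z) * t / (real q + 1)"
  proof -
    have "fst z \<bullet> fst v = (fst z \<bullet> fst z) * s" "snd z \<bullet> snd v = (snd z \<bullet> snd z) * t"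
      unfolding st scaleR_conv_of_real[symmetric] by simp_all
    then show ?thesis using v by (simp only: Tan_def mem_Collect_eq)
  qed
  moreover have "fst z \<bullet> fst z > 0" "snd z \<bullet> snd z > 0" using nz by simp_all
  moreover have "(s > 0 \<and> t < 0) \<or> (s < 0 \<and> t > 0) \<or> (s = 0 \<and> t = 0)"
  proof -
    have "real p + 1 > 0" "real q + 1 > 0" by simp_all
    with 1 show ?thesis
      by (smt (verit) mult_pos_pos mult_pos_neg mult_eq_0_iff)
  qed
  ultimately have "s = 0" "t = 0"
    by (smt (verit) divide_pos_pos divide_neg_pos mult_pos_pos mult_pos_neg of_nat_0_le_iff)+
  then show ?thesis by (simp add: st prod_eq_iff)
qed

text \<open>Both defining functions are constant along a curve in the surface, so their derivatives
  along its velocity vanish.\<close>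

lemma tangent_space_subset_Tan: "tangent_space level z \<subseteq> Tan z"
proof
  fix v assume "v \<in> tangent_space level z"
  then obtain e \<gamma> where e: "e > 0" and \<gamma>: "\<gamma> ` {-e<..<e} \<subseteq> level" "\<gamma> 0 = z"
    and der: "(\<gamma> has_vector_derivative v) (at 0)"
    unfolding tangent_space_def by blast
  have *: "k 1 = 0" if deriv: "((\<lambda>t. f (\<gamma> t)) has_derivative k) (at 0)" and const: "\<And>z. z \<in> level \<Longrightarrow> f z = e'"
    for f :: "complex \<times> complex \<Rightarrow> real" and k e'
  proof -
    have "((\<lambda>t. f (\<gamma> t)) has_derivative (\<lambda>_. 0)) (at 0)"
    proof (rule has_derivative_transform_within_open[of "\<lambda>_. e'" _ _ _ "{-e<..<e}"])
      show "e' = f (\<gamma> t)" if "t \<in> {-e<..<e}" for t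
        using that \<gamma>(1) by (intro const[symmetric]) blast
    qed (use e in auto)
    with deriv have "k = (\<lambda>_. 0)" by (rule has_derivative_unique)
    then show ?thesis by simp
  qed
  have der': "(\<gamma> has_derivative (\<lambda>t. t *\<^sub>R v)) (at 0)"
    using der by (simp add: has_vector_derivative_def)
  have 1: "((\<lambda>t. fst (\<gamma> t)) has_derivative (\<lambda>t. t *\<^sub>R fst v)) (at 0)"
    and 2: "((\<lambda>t. snd (\<gamma> t)) has_derivative (\<lambda>t. t *\<^sub>R snd v)) (at 0)"
    using has_derivative_fst[OF der'] has_derivative_snd[OF der'] by simp_all
  have "((\<lambda>t. (fst (\<gamma> t) \<bullet> fst (\<gamma> t)) / (real p + 1) - (snd (\<gamma> t) \<bullet> snd (\<gamma> t)) / (real q + 1)) has_derivative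
      (\<lambda>t. 2 * t * ((fst z \<bullet> fst v) / (real p + 1) - (snd z \<bullet> snd v) / (real q + 1)))) (at 0)"
    by (rule has_derivative_eq_rhs[OF has_derivative_diff[OF
          bounded_linear.has_derivative[OF bounded_linear_divide has_derivative_inner[OF 1 1]]
          bounded_linear.has_derivative[OF bounded_linear_divide has_derivative_inner[OF 2 2]]]])
      (simp add: fun_eq_iff \<gamma>(2) inner_commute add_divide_distrib[symmetric] algebra_simps)
  then have "2 * 1 * ((fst z \<bullet> fst v) / (real p + 1) - (snd z \<bullet> snd v) / (real q + 1)) = 0"
    by (rule *[where e' = c]) (simp add: level_def dot_square_norm)
  then have A: "(fst z \<bullet> fst v) / (real p + 1) - (snd z \<bullet> snd v) / (real q + 1) = 0"
    by simp
  have "((\<lambda>t. Re (fst (\<gamma> t) ^ Suc p * snd (\<gamma> t) ^ Suc q)) has_derivative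
      (\<lambda>t. t * Re (of_nat (Suc p) * fst z ^ p * snd z ^ Suc q * fst v
       + of_nat (Suc q) * fst z ^ Suc p * snd z ^ q * snd v))) (at 0)"
    by (rule has_derivative_eq_rhs[OF bounded_linear.has_derivative[OF bounded_linear_Re
        has_derivative_mult[OF has_derivative_power[OF 1] has_derivative_power[OF 2]]]])
      (simp add: fun_eq_iff \<gamma>(2) scaleR_conv_of_real algebra_simps)
  then have "1 * Re (of_nat (Suc p) * fst z ^ p * snd z ^ Suc q * fst v
       + of_nat (Suc q) * fst z ^ Suc p * snd z ^ q * snd v) = 0"
    by (rule *[where e' = d]) (simp add: level_def)
  with A show "v \<in> Tan z"
    unfolding Tan_def by (simp only: mem_Collect_eq mult_1_left right_minus_eq)
qed

text \<open>A tangent vector is determined by its angular parts \<open>Im (v\<^sub>j / z\<^sub>j)\<close>, and every pair of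
  angular velocities is attained by a curve \<open>F (u + t w)\<close>.\<close>

lemma Tan_subset_tangent_space:
  assumes z: "z \<in> level"
  shows "Tan z \<subseteq> tangent_space level z"
proof
  fix v assume v: "v \<in> Tan z"
  note nz = level_nonzero[OF z]
  define u where "u = (Arg (fst z), Arg (snd z))"
  have u: "u \<in> chart_dom" "F u = z"
    using F_of_polar[OF z] by (simp_all add: u_def rcis_cmod_Arg)
  define w where "w = (Im (fst v / fst z), Im (snd v / snd z))"
  have L: "bounded_linear (\<lambda>t. t *\<^sub>R w)" by (rule bounded_linear_scaleR_left)
  have "open ((\<lambda>t. u + t *\<^sub>R w) -` chart_dom)"
    by (intro open_vimage open_chart_dom continuous_intros)
  then obtain e where e: "e > 0" "ball 0 e \<subseteq> (\<lambda>t. u + t *\<^sub>R w) -` chart_dom"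
    using u(1) openE[of "(\<lambda>t. u + t *\<^sub>R w) -` chart_dom" 0] by auto
  then have chart_dom: "u + t *\<^sub>R w \<in> chart_dom" if "t \<in> {-e<..<e}" for t
    using that by (auto simp: subset_iff dist_real_def)
  define \<gamma> where "\<gamma> t = F (u + t *\<^sub>R w)" for t
  have "smooth_on {-e<..<e} \<gamma>"
    unfolding smooth_on_def \<gamma>_def
    by (intro allI k_smooth_on_affine[OF open_chart_dom open_greaterThanLessThan L])
      (use chart_dom smooth_on_F in \<open>auto simp: smooth_on_def\<close>)
  moreover have "\<gamma> ` {-e<..<e} \<subseteq> level"
    unfolding \<gamma>_def using chart_dom F_in_level by blast
  moreover have "\<gamma> 0 = z" by (simp add: \<gamma>_def u)
  moreover have "(\<gamma> has_vector_derivative DF u w) (at 0)"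
  proof -
    have "((\<lambda>t. u + t *\<^sub>R w) has_derivative (\<lambda>t. t *\<^sub>R w)) (at 0)"
      by (auto intro!: derivative_eq_intros)
    from has_derivative_compose[OF this, of F "DF u"] F_has_derivative[OF u(1)]
    have "(\<gamma> has_derivative (\<lambda>t. DF u (t *\<^sub>R w))) (at 0)"
      by (simp add: \<gamma>_def[abs_def])
    then show ?thesis
      using linear_scale[OF has_derivative_linear[OF F_has_derivative[OF u(1)]]]
      by (simp add: has_vector_derivative_def)
  qed
  ultimately have tangent: "DF u w \<in> tangent_space level z"
    unfolding tangent_space_def using e(1) by blast
  have "F1 u = fst z" "F2 u = snd z" using u(2) by (auto simp: F_def)
  then have angular: "Im (fst (DF u w) / fst z) = Im (fst v / fst z)"
      "Im (snd (DF u w) / snd z) = Im (snd v / snd z)"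
    using nz by (simp_all add: DF_def w_def)
  \<comment> \<open>The difference of the curve's velocity and \<open>v\<close> has no angular part,
    hence is zero.\<close>
  from tangent have "1 *\<^sub>R DF u w + (- 1) *\<^sub>R v \<in> Tan z"
    by (intro Tan_lincomb subsetD[OF tangent_space_subset_Tan] v)
  then have "1 *\<^sub>R DF u w + (- 1) *\<^sub>R v = 0"
    by (rule Tan_eq_0[OF z]) (use angular in \<open>simp_all add: diff_divide_distrib\<close>)
  with tangent show "v \<in> tangent_space level z" by simp
qed

lemma tangent_space_level: "z \<in> level \<Longrightarrow> tangent_space level z = Tan z"
  using Tan_subset_tangent_space tangent_space_subset_Tan by blast

end

section \<open>Lagrangian angle\<close>

text \<open>Lagrange's identity in two complex dimensions. It makes \<open>dz1_wedge_dz2\<close>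
  unimodular on Hermitian orthonormal pairs.\<close>

lemma lagrange_identity:
  "(norm (dz1_wedge_dz2 v w))\<^sup>2 + (norm (hermitian_form v w))\<^sup>2 = (norm v)\<^sup>2 * (norm w)\<^sup>2"
  by (simp add: dz1_wedge_dz2_def hermitian_form_def norm_prod_def cmod_power2 real_sqrt_pow2)
    (simp add: algebra_simps power2_eq_square)

lemma hermitian_form_self: "hermitian_form v v = of_real ((norm v)\<^sup>2)"
  by (simp add: hermitian_form_def norm_prod_def complex_norm_square[symmetric] del: of_real_power)

text \<open>When \<open>hermitian_form v w\<close> vanishes only real terms remain, so the real span
  of \<open>v\<close> and \<open>w\<close> is isotropic for the Kaehler form.\<close>

lemma hermitian_form_lincomb:
  "hermitian_form (a *\<^sub>R v + b *\<^sub>R w) (a' *\<^sub>R v + b' *\<^sub>R w) =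
    of_real (a * a') * hermitian_form v v + of_real (a * b') * hermitian_form v w
    + of_real (b * a') * cnj (hermitian_form v w) + of_real (b * b') * hermitian_form w w"
  by (simp add: hermitian_form_def scaleR_conv_of_real algebra_simps)

lemma dz1_wedge_dz2_lincomb:
  "dz1_wedge_dz2 (a *\<^sub>R v + b *\<^sub>R w) (a' *\<^sub>R v + b' *\<^sub>R w) = of_real (a * b' - b * a') * dz1_wedge_dz2 v w"
  by (simp add: dz1_wedge_dz2_def scaleR_conv_of_real algebra_simps)

lemma span_pair: "span {v, w} = {a *\<^sub>R v + b *\<^sub>R w |a b. True}" for v w :: "'a::real_vector"
  by (auto simp: span_insert span_singleton algebra_simps)

lemma inner_eq_Re_cnj: "x \<bullet> y = Re (cnj x * y)"
  by (simp add: inner_complex_def)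

lemma Im_scaleR_add_divide:
  "Im ((a *\<^sub>R x + b *\<^sub>R y) / z) = a * Im (x / z) + b * Im (y / z)"
proof -
  have "(a *\<^sub>R x + b *\<^sub>R y) / z = a *\<^sub>R (x / z) + b *\<^sub>R (y / z)"
    by (simp add: scaleR_conv_of_real add_divide_distrib)
  then show ?thesis by (metis plus_complex.sel(2) scaleR_complex.sel(2))
qed

section \<open>The Hamiltonian frame, the orientation and the angle\<close>

context level_surface
begin

text \<open>\<open>A\<close> and \<open>B\<close> are the partial derivatives of \<open>h\<close>, so \<open>(cnj A, cnj B)\<close> is the gradient of \<open>Re h\<close>.\<close>

definition A :: "complex \<times> complex \<Rightarrow> complex" where
  "A z = of_nat (Suc p) * fst z ^ p * snd z ^ Suc q"

definition B :: "complex \<times> complex \<Rightarrow> complex" where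
  "B z = of_nat (Suc q) * fst z ^ Suc p * snd z ^ q"

definition X :: "complex \<times> complex \<Rightarrow> complex \<times> complex" where
  "X z = (\<i> * fst z / of_nat (Suc p), - \<i> * snd z / of_nat (Suc q))"

definition Y :: "complex \<times> complex \<Rightarrow> complex \<times> complex" where
  "Y z = (\<i> * cnj (A z), \<i> * cnj (B z))"

text \<open>Euler's relations for the monomial \<open>h\<close>, to which the computations with
  \<open>X\<close> and \<open>Y\<close> reduce.\<close>

lemma A_mult_fst: "A z * fst z = of_nat (Suc p) * (fst z ^ Suc p * snd z ^ Suc q)"
  and B_mult_snd: "B z * snd z = of_nat (Suc q) * (fst z ^ Suc p * snd z ^ Suc q)"
  by (simp_all add: A_def B_def mult_ac)

lemma Tan_alt: "v \<in> Tan z \<longleftrightarrow>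
  Re (cnj (fst z) * fst v) / (real p + 1) = Re (cnj (snd z) * snd v) / (real q + 1) \<and>
  Re (A z * fst v + B z * snd v) = 0"
  by (simp only: Tan_def A_def B_def inner_eq_Re_cnj mem_Collect_eq)

text \<open>\<open>X\<close> generates rotations of the two coordinates at rates
  \<open>1 / (p+1)\<close> and \<open>-1 / (q+1)\<close>, which preserve both moduli and
  \<open>h\<close>.\<close>

lemma X_in_Tan: "X z \<in> Tan z"
proof -
  have "A z * fst (X z) + B z * snd (X z) =
      \<i> * (A z * fst z) / of_nat (Suc p) - \<i> * (B z * snd z) / of_nat (Suc q)"
    by (simp add: X_def mult_ac)
  also have "\<dots> = 0"
    unfolding A_mult_fst B_mult_snd by (simp del: of_nat_Suc)
  finally have "Re (A z * fst (X z) + B z * snd (X z)) = 0" by simp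
  moreover have "cnj (fst z) * fst (X z) = \<i> * of_real ((cmod (fst z))\<^sup>2 / real (Suc p))"
    "cnj (snd z) * snd (X z) = \<i> * of_real (- ((cmod (snd z))\<^sup>2 / real (Suc q)))"
    by (simp_all only: X_def of_real_divide of_real_minus complex_norm_square) (simp_all add: mult_ac)
  ultimately show ?thesis
    unfolding Tan_alt by simp
qed

text \<open>\<open>Y\<close> is orthogonal to the gradient of \<open>Re h\<close>, being \<i> times
  it. In the other condition Euler's relations turn both sides into
  \<open>Re (\<i> * cnj h)\<close>.\<close>

lemma Y_in_Tan: "Y z \<in> Tan z"
proof -
  have "A z * fst (Y z) + B z * snd (Y z) = \<i> * of_real ((cmod (A z))\<^sup>2 + (cmod (B z))\<^sup>2)"
    unfolding of_real_add complex_norm_square by (simp add: Y_def algebra_simps)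
  then have "Re (A z * fst (Y z) + B z * snd (Y z)) = 0" by simp
  moreover
  define h where "h = \<i> * cnj (fst z ^ Suc p * snd z ^ Suc q)"
  have "cnj (fst z) * fst (Y z) = \<i> * cnj (A z * fst z)" "cnj (snd z) * snd (Y z) = \<i> * cnj (B z * snd z)"
    by (simp_all add: Y_def)
  then have "cnj (fst z) * fst (Y z) = of_real (real (Suc p)) * h" "cnj (snd z) * snd (Y z) = of_real (real (Suc q)) * h"
    unfolding A_mult_fst B_mult_snd h_def by (simp_all add: mult_ac)
  then have "Re (cnj (fst z) * fst (Y z)) / (real p + 1) = Re (cnj (snd z) * snd (Y z)) / (real q + 1)"
    by (simp add: add.commute[of 1])
  ultimately show ?thesis
    unfolding Tan_alt by blast
qed

text \<open>By Euler's relations the two terms are \<open>cnj h\<close> and its negative.\<close>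

lemma hermitian_form_Y_X: "hermitian_form (Y z) (X z) = 0"
proof -
  have "hermitian_form (Y z) (X z) = cnj (A z * fst z) / of_nat (Suc p) - cnj (B z * snd z) / of_nat (Suc q)"
    by (simp add: hermitian_form_def X_def Y_def mult_ac)
  also have "\<dots> = 0"
    unfolding A_mult_fst B_mult_snd by (simp del: of_nat_Suc)
  finally show ?thesis .
qed

lemma X_Y_nonzero:
  assumes "z \<in> level"
  shows "X z \<noteq> 0" "Y z \<noteq> 0"
  using level_nonzero[OF assms] by (auto simp: X_def Y_def A_def zero_prod_def simp del: of_nat_Suc)

lemma angular_X:
  assumes "z \<in> level"
  shows "Im (fst (X z) / fst z) = 1 / (real p + 1)" "Im (snd (X z) / snd z) = - 1 / (real q + 1)"
proof -
  have "fst (X z) / fst z = \<i> * of_real (1 / (real p + 1))" "snd (X z) / snd z = \<i> * of_real (- 1 / (real q + 1))"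
    using level_nonzero[OF assms] by (simp_all add: X_def)
  then show "Im (fst (X z) / fst z) = 1 / (real p + 1)" "Im (snd (X z) / snd z) = - 1 / (real q + 1)"
    by simp_all
qed

lemma angular_Y:
  assumes "z \<in> level"
  shows "Im (fst (Y z) / fst z) = (real p + 1) * d / (cmod (fst z))\<^sup>2"
    "Im (snd (Y z) / snd z) = (real q + 1) * d / (cmod (snd z))\<^sup>2"
proof -
  define h where "h = fst z ^ Suc p * snd z ^ Suc q"
  have "Re h = d" using assms unfolding level_def h_def by blast
  have "fst (Y z) / fst z = \<i> * cnj (A z * fst z) / of_real ((cmod (fst z))\<^sup>2)"
    "snd (Y z) / snd z = \<i> * cnj (B z * snd z) / of_real ((cmod (snd z))\<^sup>2)"
    using level_nonzero[OF assms] unfolding complex_norm_square by (simp_all add: Y_def)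
  then have "fst (Y z) / fst z = \<i> * cnj h * of_real ((real p + 1) / (cmod (fst z))\<^sup>2)"
    "snd (Y z) / snd z = \<i> * cnj h * of_real ((real q + 1) / (cmod (snd z))\<^sup>2)"
    unfolding A_mult_fst B_mult_snd h_def[symmetric] by (simp_all add: mult_ac add_ac)
  then have "Im (fst (Y z) / fst z) = Re h * ((real p + 1) / (cmod (fst z))\<^sup>2)"
    "Im (snd (Y z) / snd z) = Re h * ((real q + 1) / (cmod (snd z))\<^sup>2)"
    by simp_all
  with \<open>Re h = d\<close> show "Im (fst (Y z) / fst z) = (real p + 1) * d / (cmod (fst z))\<^sup>2"
    "Im (snd (Y z) / snd z) = (real q + 1) * d / (cmod (snd z))\<^sup>2"
    by simp_all
qed

text \<open>By \<open>Tan_eq_0\<close> it suffices to match the two angular velocities of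
  \<open>v\<close>, a linear system for \<open>a\<close> and \<open>b\<close>.\<close>

lemma Tan_eq_span:
  assumes z: "z \<in> level"
  shows "Tan z = {a *\<^sub>R Y z + b *\<^sub>R X z |a b. True}"
proof (intro equalityI subsetI)
  fix v assume v: "v \<in> Tan z"
  define P Q where "P = real p + 1" and "Q = real q + 1"
  have PQ: "P > 0" "Q > 0" by (auto simp: P_def Q_def)
  define R1 R2 where "R1 = (cmod (fst z))\<^sup>2" and "R2 = (cmod (snd z))\<^sup>2"
  have R: "R1 > 0" "R2 > 0" using level_nonzero[OF z] by (auto simp: R1_def R2_def)
  define w1 w2 where "w1 = Im (fst v / fst z)" and "w2 = Im (snd v / snd z)"
  \<comment> \<open>Adding \<open>P\<close> times the first equation to \<open>Q\<close> times the
    second eliminates \<open>b\<close>; the first equation then gives \<open>b\<close>.\<close>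
  define a where "a = (P * w1 + Q * w2) / (d * (P\<^sup>2 / R1 + Q\<^sup>2 / R2))"
  define b where "b = P * (w1 - a * (P * d / R1))"
  have "P\<^sup>2 / R1 + Q\<^sup>2 / R2 > 0" using PQ R by (intro add_pos_pos divide_pos_pos) auto
  then have a: "a * (d * (P\<^sup>2 / R1 + Q\<^sup>2 / R2)) = P * w1 + Q * w2"
    unfolding a_def using d_pos by simp
  have w1: "a * (P * d / R1) + b * (1 / P) = w1"
    using PQ unfolding b_def by simp
  have "Q * (a * (Q * d / R2) + b * (- 1 / Q)) = a * (d * (P\<^sup>2 / R1 + Q\<^sup>2 / R2)) - P * w1"
    using PQ unfolding b_def by (simp add: algebra_simps power2_eq_square)
  also have "\<dots> = Q * w2" unfolding a by simp
  finally have w2: "a * (Q * d / R2) + b * (- 1 / Q) = w2" using PQ by simp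
  have "1 *\<^sub>R (a *\<^sub>R Y z + b *\<^sub>R X z) + (- 1) *\<^sub>R v \<in> Tan z"
    using v X_in_Tan Y_in_Tan by (intro Tan_lincomb) auto
  then have "1 *\<^sub>R (a *\<^sub>R Y z + b *\<^sub>R X z) + (- 1) *\<^sub>R v = 0"
  proof (rule Tan_eq_0[OF z])
    show "Im (fst (1 *\<^sub>R (a *\<^sub>R Y z + b *\<^sub>R X z) + (- 1) *\<^sub>R v) / fst z) = 0"
      unfolding fst_add fst_scaleR Im_scaleR_add_divide angular_X[OF z] angular_Y[OF z]
      using w1 by (simp add: P_def R1_def w1_def)
    show "Im (snd (1 *\<^sub>R (a *\<^sub>R Y z + b *\<^sub>R X z) + (- 1) *\<^sub>R v) / snd z) = 0"
      unfolding snd_add snd_scaleR Im_scaleR_add_divide angular_X[OF z] angular_Y[OF z]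
      using w2 by (simp add: Q_def R2_def w2_def)
  qed
  then show "v \<in> {a *\<^sub>R Y z + b *\<^sub>R X z |a b. True}" by auto
qed (blast intro: Tan_lincomb X_in_Tan Y_in_Tan)

lemma lagrangian_surface_level: "lagrangian_surface level"
  unfolding lagrangian_surface_def
proof (intro conjI ballI smooth_surface_level)
  fix z v w assume z: "z \<in> level" and "v \<in> tangent_space level z" "w \<in> tangent_space level z"
  then obtain a b a' b' where "v = a *\<^sub>R Y z + b *\<^sub>R X z" "w = a' *\<^sub>R Y z + b' *\<^sub>R X z"
    unfolding tangent_space_level[OF z] Tan_eq_span[OF z] by blast
  then show "kaehler_form v w = 0"
    unfolding kaehler_form_def by (simp add: hermitian_form_lincomb hermitian_form_Y_X hermitian_form_self)
qed

text \<open>The coefficients \<open>c\<close> and \<open>d\<close> are bound here and shadow the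
  constants of the surface.\<close>

definition ori :: "complex \<times> complex \<Rightarrow> ((complex \<times> complex) \<times> (complex \<times> complex)) set" where
  "ori z = {(a *\<^sub>R Y z + b *\<^sub>R X z, c *\<^sub>R Y z + d *\<^sub>R X z) |a b c d. a * d - b * c > 0}"

lemma inner_Y_X: "Y z \<bullet> X z = 0"
  using Re_hermitian_form[of "Y z" "X z"] by (simp add: hermitian_form_Y_X)

lemma tangent_basis_Y_X:
  assumes z: "z \<in> level"
  shows "tangent_basis level z (Y z) (X z)"
  unfolding tangent_basis_def
proof (intro conjI)
  show "Y z \<noteq> X z" using inner_Y_X[of z] X_Y_nonzero[OF z] by auto
  have "pairwise orthogonal {Y z, X z}"
    using inner_Y_X[of z] by (auto simp: pairwise_def orthogonal_def inner_commute)
  then show "independent {Y z, X z}"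
    using X_Y_nonzero[OF z] by (intro pairwise_orthogonal_independent) auto
  show "span {Y z, X z} = tangent_space level z"
    unfolding span_pair tangent_space_level[OF z] Tan_eq_span[OF z] ..
qed

lemma orientation_on_ori: "orientation_on level ori"
  unfolding orientation_on_def
proof (intro conjI ballI)
  fix z assume z: "z \<in> level"
  show "\<exists>v w. tangent_basis level z v w \<and>
      ori z = {(a *\<^sub>R v + b *\<^sub>R w, c *\<^sub>R v + d *\<^sub>R w) |a b c d. a * d - b * c > 0}"
    using tangent_basis_Y_X[OF z] unfolding ori_def by blast
  have "(Y y, X y) \<in> ori y" for y
  proof -
    have "(Y y, X y) = (1 *\<^sub>R Y y + 0 *\<^sub>R X y, 0 *\<^sub>R Y y + 1 *\<^sub>R X y)" "(1::real) * 1 - 0 * 0 > 0" by auto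
    then show ?thesis unfolding ori_def by blast
  qed
  moreover have "continuous_on level Y" "continuous_on level X"
    unfolding Y_def A_def B_def X_def by (intro continuous_intros; simp del: of_nat_Suc)+
  \<comment> \<open>The frame is global and continuous, so the whole surface serves as
    neighbourhood.\<close>
  ultimately show "\<exists>W e1 e2. openin (top_of_set level) W \<and> z \<in> W \<and>
      continuous_on W e1 \<and> continuous_on W e2 \<and> (\<forall>y\<in>W. (e1 y, e2 y) \<in> ori y)"
    using z by (intro exI[of _ level] exI[of _ Y] exI[of _ X]) simp
qed

text \<open>In each term a coordinate meets its conjugate and becomes a squared modulus, leaving the
  same conjugated monomial with positive weights.\<close>

lemma dz1_wedge_dz2_Y_X:
  assumes z: "z \<in> level"
  shows "\<exists>k>0. dz1_wedge_dz2 (Y z) (X z) = of_real k * cnj (fst z ^ p * snd z ^ q)"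
proof (intro exI conjI)
  define R1 R2 where "R1 = (cmod (fst z))\<^sup>2" and "R2 = (cmod (snd z))\<^sup>2"
  have R: "R1 > 0" "R2 > 0" using level_nonzero[OF z] by (auto simp: R1_def R2_def)
  let ?k = "real (Suc p) * R2 / real (Suc q) + real (Suc q) * R1 / real (Suc p)"
  let ?m = "fst z ^ p * snd z ^ q"
  show "?k > 0" using R by (intro add_pos_pos[of "_ / _"] divide_pos_pos mult_pos_pos) (simp_all del: of_nat_Suc)
  have "cnj (A z) * snd z = of_nat (Suc p) * of_real R2 * cnj ?m"
    "cnj (B z) * fst z = of_nat (Suc q) * of_real R1 * cnj ?m"
    unfolding R1_def R2_def complex_norm_square A_def B_def by (simp_all add: mult_ac)
  moreover have "dz1_wedge_dz2 (Y z) (X z) = cnj (A z) * snd z / of_nat (Suc q) + cnj (B z) * fst z / of_nat (Suc p)"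
    by (simp add: dz1_wedge_dz2_def Y_def X_def mult_ac)
  ultimately show "dz1_wedge_dz2 (Y z) (X z) = of_real ?k * cnj ?m"
    by (simp add: distrib_right del: of_nat_Suc complex_cnj_mult)
qed

lemma dz1_wedge_dz2_ori:
  assumes z: "z \<in> level" and "(e1, e2) \<in> ori z" "norm e1 = 1" "norm e2 = 1" "e1 \<bullet> e2 = 0"
  shows "dz1_wedge_dz2 e1 e2 = cis (- (real p * Arg (fst z) + real q * Arg (snd z)))"
proof -
  let ?m = "fst z ^ p * snd z ^ q"
  from assms(2) obtain a b a' b' where e: "e1 = a *\<^sub>R Y z + b *\<^sub>R X z" "e2 = a' *\<^sub>R Y z + b' *\<^sub>R X z"
    and pos: "a * b' - b * a' > 0"
    unfolding ori_def by blast
  obtain k where k: "k > 0" "dz1_wedge_dz2 (Y z) (X z) = of_real k * cnj ?m"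
    using dz1_wedge_dz2_Y_X[OF z] by blast
  have "Im (hermitian_form e1 e2) = 0"
    unfolding e hermitian_form_lincomb by (simp add: hermitian_form_Y_X hermitian_form_self)
  moreover have "Re (hermitian_form e1 e2) = 0"
    using assms(5) by (simp add: Re_hermitian_form)
  ultimately have "hermitian_form e1 e2 = 0" by (simp add: complex_eq_iff)
  with lagrange_identity[of e1 e2] assms(3,4) have "(norm (dz1_wedge_dz2 e1 e2))\<^sup>2 = 1"
    by simp
  then have "norm (dz1_wedge_dz2 e1 e2) = 1"
    by (metis norm_ge_zero power2_eq_1_iff neg_0_le_iff_le not_one_le_zero)
  \<comment> \<open>A number of modulus 1 is its own \<open>sgn\<close>, and \<open>sgn\<close>
    discards the positive determinant and \<open>k\<close>.\<close>
  then have "dz1_wedge_dz2 e1 e2 = sgn (of_real ((a * b' - b * a') * k) * cnj ?m)"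
    unfolding e dz1_wedge_dz2_lincomb k(2) by (simp add: sgn_eq mult.assoc)
  also have "\<dots> = sgn (cnj ?m)"
    using pos k(1) by (simp only: sgn_mult sgn_of_real) simp
  also have "cnj ?m = rcis (cmod (fst z) ^ p * cmod (snd z) ^ q) (- (real p * Arg (fst z) + real q * Arg (snd z)))"
    unfolding complex_cnj_mult complex_cnj_power
    by (simp only: rcis_cnj DeMoivre2 rcis_mult) (simp add: algebra_simps)
  also have "sgn \<dots> = cis (- (real p * Arg (fst z) + real q * Arg (snd z)))"
    using level_nonzero[OF z] by (simp add: sgn_eq rcis_def norm_mult norm_power)
  finally show ?thesis .
qed

lemma lagrangian_angle_ori:
  assumes z: "z \<in> level"
  shows "lagrangian_angle ori z = Arg (cis (- (real p * Arg (fst z) + real q * Arg (snd z))))"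
  unfolding lagrangian_angle_def
proof (rule the_equality)
  let ?c = "cis (- (real p * Arg (fst z) + real q * Arg (snd z)))"
  have "cis (Arg ?c) = ?c" by (simp add: cis_Arg sgn_eq)
  then show "- pi < Arg ?c \<and> Arg ?c \<le> pi \<and> (\<forall>(e1, e2)\<in>ori z.
      norm e1 = 1 \<and> norm e2 = 1 \<and> e1 \<bullet> e2 = 0 \<longrightarrow> cis (Arg ?c) = dz1_wedge_dz2 e1 e2)"
    using Arg_bounded dz1_wedge_dz2_ori[OF z] by auto
  fix \<beta> assume \<beta>: "- pi < \<beta> \<and> \<beta> \<le> pi \<and> (\<forall>(e1, e2)\<in>ori z.
      norm e1 = 1 \<and> norm e2 = 1 \<and> e1 \<bullet> e2 = 0 \<longrightarrow> cis \<beta> = dz1_wedge_dz2 e1 e2)"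
  \<comment> \<open>Normalizing \<open>Y\<close> and \<open>X\<close> gives an oriented orthonormal
    basis; its existence keeps the condition on \<beta> from being vacuous and so makes \<beta>
    unique.\<close>
  define e1 e2 where "e1 = (1 / norm (Y z)) *\<^sub>R Y z + 0 *\<^sub>R X z" and "e2 = 0 *\<^sub>R Y z + (1 / norm (X z)) *\<^sub>R X z"
  have "(1 / norm (Y z)) * (1 / norm (X z)) - 0 * 0 > 0" using X_Y_nonzero[OF z] by simp
  then have e: "(e1, e2) \<in> ori z" unfolding ori_def e1_def e2_def by blast
  have e': "norm e1 = 1" "norm e2 = 1" "e1 \<bullet> e2 = 0"
    using X_Y_nonzero[OF z] inner_Y_X[of z] by (simp_all add: e1_def e2_def)
  from \<beta> e e' have "cis \<beta> = ?c" using dz1_wedge_dz2_ori[OF z e e'] by auto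
  then show "\<beta> = Arg ?c" using \<beta> by (intro cis_Arg_unique[symmetric]) (auto simp: sgn_eq)
qed

lemma lagrangian_angle_rcong:
  assumes z: "z \<in> level"
  shows "[lagrangian_angle ori z + real p * Arg (fst z) + real q * Arg (snd z) = 0] (rmod (2 * pi))"
proof -
  let ?t = "- (real p * Arg (fst z) + real q * Arg (snd z))"
  \<comment> \<open>Passing to \<open>cis\<close> removes the normalization by \<open>Arg\<close>;
    equal values then differ by a multiple of \<open>2 * pi\<close>.\<close>
  have "cis (lagrangian_angle ori z) = cis ?t"
    unfolding lagrangian_angle_ori[OF z] by (subst cis_Arg) (simp_all add: sgn_eq)
  then have "sin ?t = sin (lagrangian_angle ori z) \<and> cos ?t = cos (lagrangian_angle ori z)"
    by (metis cis.sel)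
  then obtain n where "?t = lagrangian_angle ori z + 2 * pi * of_int n"
    unfolding sin_cos_eq_iff by blast
  then show ?thesis
    unfolding rcong_altdef by (intro exI[of _ n]) (simp add: algebra_simps)
qed

end

theorem corollary2:
  fixes p q :: nat and a1 a2 lam :: real and S :: "(complex \<times> complex) set"
  assumes "a1 > 0" and "a2 > 0" and "lam > 0"
    and "lam ^ (p + q) = (real p + 1) ^ p * (real q + 1) ^ q"
    and S: "S = {(z1, z2).
      (norm z1)\<^sup>2 / (real p + 1) - (norm z2)\<^sup>2 / (real q + 1) = (a1\<^sup>2 - a2\<^sup>2) / lam \<and>
      Re (z1 ^ (p + 1) * z2 ^ (q + 1)) =
        a1 ^ (p + 1) * a2 ^ (q + 1) * sqrt ((real p + 1) * (real q + 1)) / lam}"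
  shows "lagrangian_surface S \<and>
    (\<exists>ori. orientation_on S ori \<and>
      (\<forall>(z1, z2) \<in> S.
        [lagrangian_angle ori (z1, z2) + real p * Arg z1 + real q * Arg z2 = 0] (rmod (2 * pi))))"
proof -
  define c where "c = (a1\<^sup>2 - a2\<^sup>2) / lam"
  define d where "d = a1 ^ (p + 1) * a2 ^ (q + 1) * sqrt ((real p + 1) * (real q + 1)) / lam"
  have "d > 0" unfolding d_def using assms(1-3) by simp
  then interpret level_surface p q c d by unfold_locales
  have "S = level"
    unfolding S level_def c_def[symmetric] d_def[symmetric] Suc_eq_plus1 by (simp only: case_prod_unfold)
  moreover have "\<forall>(z1, z2) \<in> level.
      [lagrangian_angle ori (z1, z2) + real p * Arg z1 + real q * Arg z2 = 0] (rmod (2 * pi))"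
  proof clarify
    fix z1 z2 assume "(z1, z2) \<in> level"
    from lagrangian_angle_rcong[OF this]
    show "[lagrangian_angle ori (z1, z2) + real p * Arg z1 + real q * Arg z2 = 0] (rmod (2 * pi))"
      by (simp only: fst_conv snd_conv)
  qed
  ultimately show ?thesis
    using lagrangian_surface_level orientation_on_ori by blast
qed

end
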